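(* Let $\mathcal{H}$ be a complex separable Hilbert space, $W$ a bounded positive semi-definite operator on $\mathcal{H}$, $A\subseteq\mathcal{H}\times\mathcal{H}$ a linear relation, $b\in\operatorname{dom}P_{W,\operatorname{ran}A}$ and $x_0\in\mathcal{H}$. The following are equivalent: (i) $x_0$ is a $W$-least squares solution of the inclusion $b\in Ax$; (ii) $Ax_0+\operatorname{mul}P_{W,\operatorname{ran}A}=P_{W,\operatorname{ran}A}b+\operatorname{mul}A$; (iii) $x_0$ is a solution of the normal equation $A^*W(Ax-b)=A^*W(\operatorname{mul}A)$, i.e. $A^*W(Ax_0-b)=A^*W(\operatorname{mul}A)$.
   Context: A linear relation in $\mathcal{H}$ is a linear subspace $T$ of $\mathcal{H}\times\mathcal{H}$; operators are identified with their graphs. $\operatorname{dom}T$, $\operatorname{ran}T$ are the domain and range, $\operatorname{mul}T=\{y:(0,y)\in T\}$; for a subset $\mathcal{L}\subseteq\mathcal{H}$, $T(\mathcal{L})=\{y:(x,y)\in T\text{ for some }x\in\mathcal{L}\}$, and $Tx=T(\{x\})$ (empty if $x\notin\operatorname{dom}T$). $RT=\{(x,y): (x,z)\in T,\ (z,y)\in R\text{ for some }z\}$; $T^*=\{(x,y):\langle g,x\rangle=\langle f,y\rangle\text{ for all }(f,g)\in T\}$. Sums such as $Ax_0+\operatorname{mul}P$ and $Ax_0-b$ are sums of sets, and $A^*W(\mathcal{L})$ is the image of the set $\mathcal{L}$ under the relation $A^*W$. $\|x\|_W:=\|W^{1/2}x\|$. A vector $x_0\in\mathcal{H}$ is a $W$-least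 squares solution of the inclusion $b\in Ax$ if $x_0\in\operatorname{dom}A$ and there exists $z\in Ax_0$ with $\|z-b\|_W=\min_{y\in\operatorname{ran}A}\|y-b\|_W$. For a (not necessarily closed) subspace $\mathcal{S}$, $P_{W,\mathcal{S}}:=\{(s+n,s):s\in\mathcal{S},\ n\in(W\mathcal{S})^\perp\}$, where $(W\mathcal{S})^\perp=\{x:\langle Wx,s\rangle=0\ \forall s\in\mathcal{S}\}$. *)

theory Defs
  imports "HOL-Analysis.Analysis" "HOL-Library.Set_Algebras" "HOL-Library.Nonpos_Ints"
begin

section \<open>Complex Hilbert spaces\<close>

text \<open>The inner product is linear in its first argument. Its positivity and definiteness come from
  \<open>cinner_norm\<close>, which says that \<open>norm\<close> is the norm it induces; completeness is inherited from
  \<^class>\<open>banach\<close>.\<close>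

class complex_hilbert = banach +
  fixes scaleC :: "complex \<Rightarrow> 'a \<Rightarrow> 'a" (infixr \<open>*\<^sub>C\<close> 75)
    and cinner :: "'a \<Rightarrow> 'a \<Rightarrow> complex"
  assumes scaleC_add_right: "c *\<^sub>C (x + y) = c *\<^sub>C x + c *\<^sub>C y"
    and scaleC_add_left: "(c + d) *\<^sub>C x = c *\<^sub>C x + d *\<^sub>C x"
    and scaleC_scaleC: "c *\<^sub>C d *\<^sub>C x = (c * d) *\<^sub>C x"
    and scaleC_one: "1 *\<^sub>C x = x"
    and scaleR_scaleC: "r *\<^sub>R x = complex_of_real r *\<^sub>C x"
    and cinner_commute: "cinner x y = cnj (cinner y x)"
    and cinner_add_left: "cinner (x + y) z = cinner x z + cinner y z"
    and cinner_scaleC_left: "cinner (c *\<^sub>C x) y = c * cinner x y"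
    and cinner_norm: "cinner x x = complex_of_real ((norm x)\<^sup>2)"

section \<open>Positive operators\<close>

definition bounded_clinear :: "('h::complex_hilbert \<Rightarrow> 'h) \<Rightarrow> bool" where
  "bounded_clinear W \<longleftrightarrow> bounded_linear W \<and> (\<forall>c x. W (c *\<^sub>C x) = c *\<^sub>C W x)"

text \<open>As the scalars are complex, this implies that \<open>W\<close> is self-adjoint.\<close>

definition pos_semidef :: "('h::complex_hilbert \<Rightarrow> 'h) \<Rightarrow> bool" where
  "pos_semidef W \<longleftrightarrow> (\<forall>x. cinner (W x) x \<in> \<real>\<^sub>\<ge>\<^sub>0)"

text \<open>\<open>W\<^sup>1\<^sup>/\<^sup>2\<close>, the unique positive square root; meaningful only for bounded positive semi-definite
  \<open>W\<close>.\<close>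

definition op_sqrt :: "('h::complex_hilbert \<Rightarrow> 'h) \<Rightarrow> 'h \<Rightarrow> 'h" where
  "op_sqrt W = (THE R. bounded_clinear R \<and> pos_semidef R \<and> R \<circ> R = W)"

definition wnorm :: "('h::complex_hilbert \<Rightarrow> 'h) \<Rightarrow> 'h \<Rightarrow> real" where
  "wnorm W x = norm (op_sqrt W x)"

section \<open>Linear relations\<close>

text \<open>The domain, the range and the image \<open>T(L)\<close> of a relation are \<^const>\<open>Domain\<close>, \<^const>\<open>Range\<close>
  and \<open>T `` L\<close>; in particular \<open>Tx\<close> is \<open>T `` {x}\<close>.\<close>

definition linear_relation :: "('h::complex_hilbert \<times> 'h) set \<Rightarrow> bool" where
  "linear_relation T \<longleftrightarrow>
     (0, 0) \<in> T \<and>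
     (\<forall>x y x' y'. (x, y) \<in> T \<longrightarrow> (x', y') \<in> T \<longrightarrow> (x + x', y + y') \<in> T) \<and>
     (\<forall>c x y. (x, y) \<in> T \<longrightarrow> (c *\<^sub>C x, c *\<^sub>C y) \<in> T)"

definition mul :: "('h::complex_hilbert \<times> 'h) set \<Rightarrow> 'h set" where
  "mul T = {y. (0, y) \<in> T}"

definition graph :: "('h \<Rightarrow> 'h) \<Rightarrow> ('h::complex_hilbert \<times> 'h) set" where
  "graph W = {(x, W x) | x. True}"

text \<open>The product \<open>RT\<close> applies \<open>T\<close> first, whereas \<^const>\<open>relcomp\<close> applies its left argument first.\<close>

definition relation_product :: "('h::complex_hilbert \<times> 'h) set \<Rightarrow> ('h \<times> 'h) set \<Rightarrow> ('h \<times> 'h) set" where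
  "relation_product R T = T O R"

definition rel_adj :: "('h::complex_hilbert \<times> 'h) set \<Rightarrow> ('h \<times> 'h) set" where
  "rel_adj T = {(x, y). \<forall>(f, g) \<in> T. cinner g x = cinner f y}"

section \<open>Weighted projections and weighted least squares\<close>

text \<open>\<open>(W S)\<^sup>\<bottom>\<close>\<close>

definition wperp :: "('h::complex_hilbert \<Rightarrow> 'h) \<Rightarrow> 'h set \<Rightarrow> 'h set" where
  "wperp W S = {x. \<forall>s \<in> S. cinner (W x) s = 0}"

definition wproj :: "('h::complex_hilbert \<Rightarrow> 'h) \<Rightarrow> 'h set \<Rightarrow> ('h \<times> 'h) set" where
  "wproj W S = {(s + n, s) | s n. s \<in> S \<and> n \<in> wperp W S}"

text \<open>Since \<open>z \<in> Ax\<^sub>0\<close> lies in the range of \<open>A\<close>, the inequality says that the minimum over the range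
  exists and is attained at \<open>z\<close>.\<close>

definition wls_solution ::
  "('h::complex_hilbert \<Rightarrow> 'h) \<Rightarrow> ('h \<times> 'h) set \<Rightarrow> 'h \<Rightarrow> 'h \<Rightarrow> bool" where
  "wls_solution W A b x0 \<longleftrightarrow>
     x0 \<in> Domain A \<and>
     (\<exists>z \<in> A `` {x0}. \<forall>y \<in> Range A. wnorm W (z - b) \<le> wnorm W (y - b))"

text \<open>The set \<open>M - b\<close>; the operation \<open>-\<close> on sets is already the set difference.\<close>

definition set_minus_vec :: "'h::complex_hilbert set \<Rightarrow> 'h \<Rightarrow> 'h set" where
  "set_minus_vec M b = {z - b | z. z \<in> M}"

text \<open>Sums of sets are the \<open>+\<close> of \<^theory>\<open>HOL-Library.Set_Algebras\<close>.\<close>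

end

theory Submission
  imports Defs
begin

text \<open>Write \<open>b = s + n\<close> with \<open>s\<close> in the range \<open>S\<close> of \<open>A\<close> and \<open>n \<in> (W S)\<^sup>\<bottom>\<close>. By the usual variational
  argument for the quadratic form \<open>v \<mapsto> \<langle>W v, v\<rangle> = \<parallel>v\<parallel>\<^sub>W\<^sup>2\<close>, a point \<open>z\<close> of \<open>A x\<^sub>0\<close> is a best approximation
  of \<open>b\<close> iff \<open>z - b \<in> (W S)\<^sup>\<bottom>\<close>, and this condition can be read both as \<open>z - s \<in> S \<inter> (W S)\<^sup>\<bottom>\<close> (the
  multivalued part of the projection) and as \<open>0 \<in> A\<^sup>*W(z - b)\<close>. The identity
  \<open>\<langle>W v, v\<rangle> = \<parallel>v\<parallel>\<^sub>W\<^sup>2\<close> rests on the existence and uniqueness of \<open>W\<^sup>1\<^sup>/\<^sup>2\<close>. After scaling, \<open>T = I - W\<close> is a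
  contraction and \<open>W\<^sup>1\<^sup>/\<^sup>2 = I - Y\<close>, where \<open>Y = (T + Y\<^sup>2) / 2\<close> is the limit of the iteration started
  at \<open>0\<close>, whose increments are dominated by those of the same iteration for \<open>T = 1\<close> in \<open>\<real>\<close>.\<close>

section \<open>The complex inner product\<close>

lemma cinner_add_right: "cinner x (y + z) = cinner x y + cinner x (z::'a::complex_hilbert)"
  by (metis cinner_add_left cinner_commute complex_cnj_add)

lemma cinner_scaleC_right: "cinner x (c *\<^sub>C y) = cnj c * cinner x (y::'a::complex_hilbert)"
  by (metis cinner_scaleC_left cinner_commute complex_cnj_mult)

text \<open>The normed-space axioms give homogeneity over the reals only; for complex scalars it is
  recovered from \<open>cinner_norm\<close>.\<close>

lemma norm_scaleC: "norm (c *\<^sub>C (x::'a::complex_hilbert)) = cmod c * norm x"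
proof -
  have "complex_of_real ((norm (c *\<^sub>C x))\<^sup>2) = (c * cnj c) * cinner x x"
    unfolding cinner_norm[symmetric] by (simp add: cinner_scaleC_left cinner_scaleC_right)
  also have "\<dots> = complex_of_real ((cmod c * norm x)\<^sup>2)"
    by (simp add: cinner_norm complex_norm_square[symmetric] power_mult_distrib)
  finally have "(norm (c *\<^sub>C x))\<^sup>2 = (cmod c * norm x)\<^sup>2"
    using of_real_eq_iff by blast
  then show ?thesis
    by (simp add: power2_eq_iff_nonneg)
qed

lemma norm_add_square:
  "(norm (x + y))\<^sup>2 = (norm x)\<^sup>2 + 2 * Re (cinner x y) + (norm (y::'a::complex_hilbert))\<^sup>2"
proof -
  have "complex_of_real ((norm (x + y))\<^sup>2) = cinner x x + cinner x y + cnj (cinner x y) + cinner y y"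
    unfolding cinner_norm[symmetric] cinner_commute[of x y, symmetric]
    by (simp add: cinner_add_left cinner_add_right cinner_commute[of y x])
  then have "Re (complex_of_real ((norm (x + y))\<^sup>2)) =
      Re (cinner x x + cinner x y + cnj (cinner x y) + cinner y y)"
    by simp
  then show ?thesis
    by (simp add: cinner_norm del: of_real_power)
qed

text \<open>The usual order is reversed: the triangle inequality is part of the class, and squaring
  it bounds the cross term.\<close>

lemma Re_cinner_le: "Re (cinner x y) \<le> norm x * norm (y::'a::complex_hilbert)"
proof -
  have "(norm (x + y))\<^sup>2 \<le> (norm x + norm y)\<^sup>2"
    by (simp add: norm_triangle_ineq power_mono)
  then show ?thesis
    using norm_add_square[of x y] by (simp add: power2_sum)
qed

lemma cmod_cinner_le: "cmod (cinner x y) \<le> norm x * norm (y::'a::complex_hilbert)"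
proof (cases "cinner x y = 0")
  case False
  \<comment> \<open>A unimodular phase that rotates \<open>cinner x y\<close> onto the nonnegative
    real axis, where modulus and real part agree.\<close>
  define c where "c = cnj (cinner x y) / cmod (cinner x y)"
  have c: "cmod c = 1" "c * cinner x y = cmod (cinner x y)"
    using False complex_norm_square[of "cinner x y"]
    by (auto simp: c_def norm_divide field_simps power2_eq_square)
  have "cmod (cinner x y) = Re (cinner (c *\<^sub>C x) y)"
    using c(2) by (simp add: cinner_scaleC_left)
  also have "\<dots> \<le> norm (c *\<^sub>C x) * norm y"
    by (rule Re_cinner_le)
  finally show ?thesis
    using c(1) by (simp add: norm_scaleC)
qed simp

lemma cinner_scaleR_left: "cinner (r *\<^sub>R x) y = r *\<^sub>R cinner x (y::'a::complex_hilbert)"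
  by (simp add: scaleR_scaleC cinner_scaleC_left scaleR_conv_of_real)

lemma cinner_scaleR_right: "cinner x (r *\<^sub>R y) = r *\<^sub>R cinner x (y::'a::complex_hilbert)"
  by (simp add: scaleR_scaleC cinner_scaleC_right scaleR_conv_of_real)

text \<open>Boundedness is Cauchy-Schwarz. The limit rule obtained here later carries
  self-adjointness over to a pointwise limit.\<close>

interpretation cinner: bounded_bilinear "cinner :: 'a::complex_hilbert \<Rightarrow> 'a \<Rightarrow> complex"
proof
  show "\<exists>K. \<forall>x y::'a. norm (cinner x y) \<le> norm x * norm y * K"
    using cmod_cinner_le by (intro exI[of _ 1]) auto
qed (simp_all add: cinner_add_left cinner_add_right cinner_scaleR_left cinner_scaleR_right)

lemma bounded_linear_scaleC: "bounded_linear (\<lambda>x::'a::complex_hilbert. c *\<^sub>C x)"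
proof (rule bounded_linear_intro[where K = "cmod c"])
  show "c *\<^sub>C r *\<^sub>R x = r *\<^sub>R c *\<^sub>C x" for r and x :: 'a
    by (simp add: scaleR_scaleC scaleC_scaleC mult.commute)
qed (simp_all add: scaleC_add_right norm_scaleC mult.commute)

lemma scaleC_diff_right: "c *\<^sub>C (x - y) = c *\<^sub>C x - c *\<^sub>C (y::'a::complex_hilbert)"
  by (rule linear_diff[OF bounded_linear.linear[OF bounded_linear_scaleC]])

lemma uminus_eq_scaleC: "- x = (- 1) *\<^sub>C (x::'a::complex_hilbert)"
  using scaleR_scaleC[of "- 1" x] by simp

section \<open>Positive operators\<close>

text \<open>Polarization: the form is real at \<open>x + y\<close>, which settles imaginary parts,
  and at \<open>x + \<i> *\<^sub>C y\<close>, which settles real parts.\<close>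

lemma pos_semidef_selfadjoint:
  assumes "bounded_clinear W" "pos_semidef W"
  shows "cinner (W x) y = cinner x (W y)"
proof -
  interpret bounded_linear W
    using assms(1) by (simp add: bounded_clinear_def)
  have scale: "W (c *\<^sub>C v) = c *\<^sub>C W v" for c v
    using assms(1) by (simp add: bounded_clinear_def)
  have real: "Im (cinner (W v) v) = 0" for v
    using assms(2) by (auto simp: pos_semidef_def complex_nonneg_Reals_iff)
  have "Im (cinner (W x) y) = - Im (cinner (W y) x)"
    using real[of "x + y"] real[of x] real[of y]
    by (simp add: add cinner_add_left cinner_add_right)
  moreover have "Re (cinner (W x) y) = Re (cinner (W y) x)"
    using real[of "x + \<i> *\<^sub>C y"] real[of x] real[of y]
    by (simp add: add scale cinner_add_left cinner_add_right cinner_scaleC_left cinner_scaleC_right)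
  ultimately have "cinner (W x) y = cnj (cinner (W y) x)"
    by (simp add: complex_eq_iff)
  then show ?thesis
    by (simp add: cinner_commute[symmetric])
qed

lemma pos_semidef_Re_nonneg: "pos_semidef W \<Longrightarrow> 0 \<le> Re (cinner (W x) x)"
  by (auto simp: pos_semidef_def complex_nonneg_Reals_iff)

lemma Re_cinner_form_add:
  assumes "bounded_clinear W" "pos_semidef W"
  shows "Re (cinner (W (u + v)) (u + v)) =
    Re (cinner (W u) u) + 2 * Re (cinner (W u) v) + Re (cinner (W v) v)"
proof -
  have "W (u + v) = W u + W v"
    using assms(1) by (simp add: bounded_clinear_def linear_simps)
  moreover have "cinner (W v) u = cnj (cinner (W u) v)"
    unfolding pos_semidef_selfadjoint[OF assms, of v u] by (rule cinner_commute)
  ultimately show ?thesis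
    by (simp add: cinner_add_left cinner_add_right)
qed

text \<open>First-order condition at a minimum: if \<open>cinner (W u) s\<close> were nonzero, a
  small step against it would lower the form, since the linear term beats the quadratic one.\<close>

lemma cinner_eq_0_if_form_minimal:
  assumes W: "bounded_clinear W" "pos_semidef W"
    and min: "\<And>c. Re (cinner (W u) u) \<le> Re (cinner (W (u + c *\<^sub>C s)) (u + c *\<^sub>C s))"
  shows "cinner (W u) s = 0"
proof (rule ccontr)
  define a where "a = cinner (W u) s"
  define q where "q = Re (cinner (W s) s)"
  \<comment> \<open>The summand 1 covers \<open>q = 0\<close> and forces \<open>t * q < 1\<close>,
    so that the factor \<open>t * q - 2\<close> below is negative.\<close>
  define t where "t = 1 / (q + 1)"
  \<comment> \<open>The second slot is conjugate-linear, so this choice makes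
    \<open>cinner (W u) (c *\<^sub>C s)\<close> equal to \<open>- t\<close> times the squared
    modulus of \<open>a\<close>.\<close>
  define c where "c = complex_of_real (- t) * a"
  assume "cinner (W u) s \<noteq> 0"
  then have a: "0 < (cmod a)\<^sup>2"
    by (simp add: a_def)
  have q: "0 \<le> q"
    unfolding q_def by (rule pos_semidef_Re_nonneg[OF W(2)])
  have t: "0 < t" "t * q < 1"
    using q by (auto simp: t_def field_simps)
  have Wc: "W (c *\<^sub>C s) = c *\<^sub>C W s"
    using W(1) by (simp add: bounded_clinear_def)
  have "Re (cinner (W u) (c *\<^sub>C s)) = - t * (cmod a)\<^sup>2"
    unfolding cinner_scaleC_right a_def[symmetric] c_def
    by (simp add: cmod_def power2_eq_square algebra_simps)
  moreover have "Re (cinner (W (c *\<^sub>C s)) (c *\<^sub>C s)) = t\<^sup>2 * (cmod a)\<^sup>2 * q"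
  proof -
    have "c * cnj c = complex_of_real (t\<^sup>2 * (cmod a)\<^sup>2)"
      unfolding complex_norm_square[of c, symmetric] by (simp add: c_def norm_mult power_mult_distrib)
    moreover have "cinner (W (c *\<^sub>C s)) (c *\<^sub>C s) = (c * cnj c) * cinner (W s) s"
      by (simp add: Wc cinner_scaleC_left cinner_scaleC_right)
    ultimately show ?thesis
      by (simp only: q_def Re_complex_of_real times_complex.sel Im_complex_of_real)
  qed
  ultimately have "0 \<le> - (2 * t) * (cmod a)\<^sup>2 + t\<^sup>2 * (cmod a)\<^sup>2 * q"
    using min[of c] Re_cinner_form_add[OF W, of u "c *\<^sub>C s"] by simp
  also have "\<dots> = t * (cmod a)\<^sup>2 * (t * q - 2)"
    by (simp add: algebra_simps power2_eq_square)
  also have "\<dots> < 0"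
    using a t by (intro mult_pos_neg mult_pos_pos) auto
  finally show False by simp
qed

text \<open>A zero of a nonnegative form is a minimizer, so the first-order condition applies in the
  direction \<open>s = W u\<close>.\<close>

lemma pos_semidef_eq_0:
  assumes "bounded_clinear W" "pos_semidef W" "Re (cinner (W u) u) = 0"
  shows "W u = 0"
proof -
  have "cinner (W u) (W u) = 0"
    using assms by (intro cinner_eq_0_if_form_minimal) (auto simp: pos_semidef_Re_nonneg)
  then show ?thesis
    by (simp add: cinner_norm)
qed

section \<open>The positive square root\<close>

primrec half_iter :: "('a::real_vector \<Rightarrow> 'a) \<Rightarrow> nat \<Rightarrow> 'a \<Rightarrow> 'a" where
  "half_iter T 0 x = 0"
| "half_iter T (Suc n) x = (1/2) *\<^sub>R (T x + half_iter T n (half_iter T n x))"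

primrec half_bound :: "nat \<Rightarrow> real" where
  "half_bound 0 = 0"
| "half_bound (Suc n) = (1 + (half_bound n)\<^sup>2) / 2"

lemma half_bound_range: "0 \<le> half_bound n \<and> half_bound n \<le> 1"
  by (induction n) (auto simp: power_le_one)

text \<open>Each increment is half the square of \<open>1 - half_bound n\<close>.\<close>

lemma incseq_half_bound: "incseq half_bound"
proof (rule incseq_SucI)
  fix n
  have "0 \<le> (1 - half_bound n)\<^sup>2"
    by simp
  then show "half_bound n \<le> half_bound (Suc n)"
    by (simp add: power2_diff)
qed

lemma Cauchy_half_bound: "Cauchy half_bound"
proof -
  obtain L where "half_bound \<longlonglongrightarrow> L"
    using incseq_convergent[OF incseq_half_bound] half_bound_range by blast
  then show ?thesis
    by (rule LIMSEQ_imp_Cauchy)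
qed

lemma bounded_linear_half_iter:
  assumes "bounded_linear T"
  shows "bounded_linear (half_iter T n)"
proof (induction n)
  case 0
  have "half_iter T 0 = (\<lambda>x. 0)"
    by (rule ext) simp
  then show ?case
    by (simp only: bounded_linear_zero)
next
  case (Suc n)
  have "half_iter T (Suc n) = (\<lambda>x. (1/2) *\<^sub>R (T x + half_iter T n (half_iter T n x)))"
    by (rule ext) simp
  moreover have "bounded_linear \<dots>"
    by (rule bounded_linear_const_scaleR[OF bounded_linear_add[OF assms
          bounded_linear_compose[OF Suc.IH Suc.IH]]])
  ultimately show ?case
    by (simp only:)
qed

text \<open>For linear \<open>T\<close> the iterates are polynomials in \<open>T\<close>. The
  commutation later yields both complex linearity of the root and its uniqueness.\<close>

lemma half_iter_commute:
  assumes "bounded_linear U" "\<And>x. U (T x) = T (U x)"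
  shows "U (half_iter T n x) = half_iter T n (U x)"
proof -
  interpret U: bounded_linear U by fact
  show ?thesis
    by (induction n arbitrary: x) (simp_all add: U.zero U.scaleR U.add assms(2))
qed

lemma half_iter_selfadjoint:
  assumes "\<And>x y. cinner (T x) y = cinner x (T y)"
  shows "cinner (half_iter T n x) y = cinner x (half_iter T n y)"
  by (induction n arbitrary: x y)
    (simp_all add: cinner.zero_left cinner.zero_right cinner_scaleR_left cinner_scaleR_right
      cinner_add_left cinner_add_right assms)

section \<open>Pointwise convergence of the iteration for a contraction\<close>

context
  fixes T :: "'a::banach \<Rightarrow> 'a"
  assumes lin: "bounded_linear T" and contr: "\<And>x. norm (T x) \<le> norm x"
begin

lemma norm_half_iter: "norm (half_iter T n x) \<le> half_bound n * norm x"
proof (induction n arbitrary: x)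
  case (Suc n)
  have "norm (half_iter T n (half_iter T n x)) \<le> half_bound n * norm (half_iter T n x)"
    by (rule Suc.IH)
  also have "\<dots> \<le> half_bound n * (half_bound n * norm x)"
    using Suc.IH half_bound_range by (intro mult_left_mono) auto
  finally have "norm (T x + half_iter T n (half_iter T n x)) \<le> norm x + (half_bound n)\<^sup>2 * norm x"
    using contr[of x] norm_triangle_ineq[of "T x" "half_iter T n (half_iter T n x)"]
    by (simp add: power2_eq_square mult.assoc)
  then show ?case
    by (simp add: distrib_right del: scaleR_add_right)
qed simp

text \<open>With \<open>r\<close> and \<open>s\<close> the scalar bounds at \<open>n\<close> and
  \<open>Suc n\<close>, the two terms of the difference of squares contribute
  \<open>s * (s - r)\<close> and \<open>(s - r) * r\<close>. Their sum is \<open>s^2 - r^2\<close>,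
  twice the next scalar increment.\<close>

lemma norm_half_iter_step:
  "norm (half_iter T (Suc n) x - half_iter T n x) \<le> (half_bound (Suc n) - half_bound n) * norm x"
proof (induction n arbitrary: x)
  case 0
  then show ?case
    using contr[of x] by simp
next
  case (Suc n)
  interpret R: bounded_linear "half_iter T (Suc n)"
    by (rule bounded_linear_half_iter[OF lin])
  let ?r = "half_bound n" and ?s = "half_bound (Suc n)"
  let ?D = "\<lambda>x. half_iter T (Suc n) x - half_iter T n x"
  have d: "0 \<le> ?s - ?r"
    using incseq_half_bound by (simp add: incseq_Suc_iff del: half_bound.simps)
  \<comment> \<open>The terms in \<open>T\<close> cancel, and the difference of the squares is split
    through the mixed product of the two iterates.\<close>
  have "half_iter T (Suc (Suc n)) x - half_iter T (Suc n) x =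
      (1/2) *\<^sub>R (half_iter T (Suc n) (?D x) + ?D (half_iter T n x))"
    unfolding half_iter.simps(2)[of T "Suc n" x] R.diff
    by (subst half_iter.simps(2)[of T n x], simp add: algebra_simps del: half_iter.simps(2))
      (simp add: algebra_simps)
  moreover have "norm (half_iter T (Suc n) (?D x)) \<le> ?s * ((?s - ?r) * norm x)"
    using norm_half_iter[of "Suc n" "?D x"] Suc.IH[of x] half_bound_range[of "Suc n"]
    by (meson mult_left_mono order_trans)
  moreover have "norm (?D (half_iter T n x)) \<le> (?s - ?r) * (?r * norm x)"
    using Suc.IH[of "half_iter T n x"] norm_half_iter[of n x] d
    by (meson mult_left_mono order_trans)
  ultimately have "norm (half_iter T (Suc (Suc n)) x - half_iter T (Suc n) x)
      \<le> (?s * ((?s - ?r) * norm x) + (?s - ?r) * (?r * norm x)) / 2"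
    using norm_triangle_ineq[of "half_iter T (Suc n) (?D x)" "?D (half_iter T n x)"]
    by (simp del: half_iter.simps half_bound.simps)
  also have "\<dots> = ((1 + ?s\<^sup>2) / 2 - (1 + ?r\<^sup>2) / 2) * norm x"
    by (simp add: field_simps power2_eq_square del: half_bound.simps)
  finally show ?case
    by simp
qed

lemma norm_half_iter_diff:
  assumes "n \<le> m"
  shows "norm (half_iter T m x - half_iter T n x) \<le> (half_bound m - half_bound n) * norm x"
  using assms
proof (induction m rule: dec_induct)
  case (step m)
  have "norm (half_iter T (Suc m) x - half_iter T n x) \<le>
      norm (half_iter T (Suc m) x - half_iter T m x) + norm (half_iter T m x - half_iter T n x)"
    using norm_triangle_ineq[of "half_iter T (Suc m) x - half_iter T m x" "half_iter T m x - half_iter T n x"]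
    by (simp del: half_iter.simps)
  then show ?case
    using norm_half_iter_step[of m x] step.IH
    by (simp add: left_diff_distrib del: half_iter.simps half_bound.simps)
qed simp

lemma convergent_half_iter: "convergent (\<lambda>n. half_iter T n x)"
proof -
  have *: "dist (half_iter T m x) (half_iter T n x) \<le> dist (half_bound m) (half_bound n) * norm x" for m n
  proof (cases "n \<le> m")
    case True
    then show ?thesis
      using norm_half_iter_diff[OF True, of x] incseqD[OF incseq_half_bound True]
      by (simp add: dist_norm)
  next
    case False
    then have "m \<le> n" by simp
    then show ?thesis
      using norm_half_iter_diff[OF \<open>m \<le> n\<close>, of x] incseqD[OF incseq_half_bound \<open>m \<le> n\<close>]
      by (simp add: dist_norm norm_minus_commute)
  qed
  have "Cauchy (\<lambda>n. half_iter T n x)"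
  proof (rule metric_CauchyI)
    fix e :: real assume "0 < e"
    \<comment> \<open>The summand 1 keeps the divisor positive when \<open>x = 0\<close>.\<close>
    then have "0 < e / (norm x + 1)"
      by (simp add: add_nonneg_pos)
    then obtain M where M: "\<And>m n. M \<le> m \<Longrightarrow> M \<le> n \<Longrightarrow> dist (half_bound m) (half_bound n) < e / (norm x + 1)"
      using metric_CauchyD[OF Cauchy_half_bound] by blast
    have "dist (half_iter T m x) (half_iter T n x) < e" if "M \<le> m" "M \<le> n" for m n
    proof -
      have "dist (half_iter T m x) (half_iter T n x) \<le> dist (half_bound m) (half_bound n) * (norm x + 1)"
        using *[of m n] by (smt (verit) mult_left_mono zero_le_dist)
      also have "\<dots> < e"
        using M[OF that] by (simp add: pos_less_divide_eq add_nonneg_pos)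
      finally show ?thesis .
    qed
    then show "\<exists>M. \<forall>m\<ge>M. \<forall>n\<ge>M. dist (half_iter T m x) (half_iter T n x) < e"
      by blast
  qed
  then show ?thesis
    by (rule Cauchy_convergent)
qed

text \<open>Completeness gives the limit at each vector. Contractivity of all iterates bounds it and
  lets the recursion pass to the limit.\<close>

lemma half_iter_limit:
  obtains Y where "bounded_linear Y" "\<And>x. norm (Y x) \<le> norm x"
    "\<And>x. 2 *\<^sub>R Y x = T x + Y (Y x)" "\<And>x. (\<lambda>n. half_iter T n x) \<longlonglongrightarrow> Y x"
proof -
  define Y where "Y x = lim (\<lambda>n. half_iter T n x)" for x
  have lim: "(\<lambda>n. half_iter T n x) \<longlonglongrightarrow> Y x" for x
    using convergent_half_iter by (simp add: Y_def convergent_LIMSEQ_iff)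
  have nle: "norm (half_iter T n x) \<le> norm x" for n x
    using norm_half_iter[of n x] half_bound_range[of n]
    by (meson mult_left_le_one_le norm_ge_zero order_trans)
  have norm: "norm (Y x) \<le> norm x" for x
    using lim nle by (intro LIMSEQ_le_const2[OF tendsto_norm[OF lim]]) auto
  have lin_iter: "linear (half_iter T n)" for n
    using bounded_linear_half_iter[OF lin] by (rule bounded_linear.linear)
  have Y: "bounded_linear Y"
  proof (rule bounded_linear_intro[where K = 1])
    show "Y (x + y) = Y x + Y y" for x y
      using lim[of "x + y"] tendsto_add[OF lim[of x] lim[of y]]
      by (auto simp: linear_add[OF lin_iter] intro: LIMSEQ_unique)
    show "Y (r *\<^sub>R x) = r *\<^sub>R Y x" for r x
      using lim[of "r *\<^sub>R x"] tendsto_scaleR[OF tendsto_const[of r] lim[of x]]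
      by (auto simp: linear_scale[OF lin_iter] intro: LIMSEQ_unique)
  qed (simp add: norm)
  have eq: "2 *\<^sub>R Y x = T x + Y (Y x)" for x
  proof -
    \<comment> \<open>In the square both the operator and its argument vary with \<open>n\<close>.
      Each iterate is a contraction, so freezing the argument at \<open>Y x\<close> costs at most
      \<open>norm (half_iter T n x - Y x)\<close>.\<close>
    have "(\<lambda>n. half_iter T n (half_iter T n x) - half_iter T n (Y x)) \<longlonglongrightarrow> 0"
    proof (rule Lim_null_comparison)
      show "\<forall>\<^sub>F n in sequentially. norm (half_iter T n (half_iter T n x) - half_iter T n (Y x))
          \<le> norm (half_iter T n x - Y x)"
        using nle by (simp add: linear_diff[OF lin_iter, symmetric])
      show "(\<lambda>n. norm (half_iter T n x - Y x)) \<longlonglongrightarrow> 0"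
        using lim by (simp add: tendsto_norm_zero LIM_zero)
    qed
    from tendsto_add[OF this lim[of "Y x"]]
    have "(\<lambda>n. T x + half_iter T n (half_iter T n x)) \<longlonglongrightarrow> T x + Y (Y x)"
      by (intro tendsto_add tendsto_const) simp
    \<comment> \<open>By the recursion this sequence is twice the shifted sequence of
      iterates.\<close>
    moreover have "(\<lambda>n. T x + half_iter T n (half_iter T n x)) \<longlonglongrightarrow> 2 *\<^sub>R Y x"
      using tendsto_scaleR[OF tendsto_const[of 2] LIMSEQ_Suc[OF lim[of x]]] by simp
    ultimately show ?thesis
      using LIMSEQ_unique by blast
  qed
  show ?thesis
    by (rule that[OF Y norm eq lim])
qed

end

text \<open>Besides the root itself, commutation with everything that commutes with \<open>W\<close>
  is recorded, because the uniqueness proof relies on it.\<close>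

lemma positive_contraction_sqrt:
  assumes W: "bounded_clinear W" "pos_semidef W" and contr: "\<And>x. norm (W x) \<le> norm x"
  obtains R where "bounded_clinear R" "pos_semidef R" "R \<circ> R = W"
    "\<And>U x. bounded_linear U \<Longrightarrow> (\<And>x. U (W x) = W (U x)) \<Longrightarrow> U (R x) = R (U x)"
proof -
  define T where "T = (\<lambda>x. x - W x)"
  interpret W: bounded_linear W
    using W(1) by (simp add: bounded_clinear_def)
  have Wc: "W (c *\<^sub>C x) = c *\<^sub>C W x" for c x
    using W(1) by (simp add: bounded_clinear_def)
  have T: "bounded_linear T"
    unfolding T_def by (intro bounded_linear_sub bounded_linear_ident W.bounded_linear_axioms)
  have adj: "cinner (T x) y = cinner x (T y)" for x y
    by (simp add: T_def cinner.diff_left cinner.diff_right pos_semidef_selfadjoint[OF W])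
  \<comment> \<open>Positivity at \<open>x - W x\<close> together with contractivity of
    \<open>W\<close> gives that the squared norm of \<open>W x\<close> is at most
    \<open>cinner (W x) x\<close>; expanding the squared norm of \<open>x - W x\<close> then
    finishes.\<close>
  have Tcontr: "norm (T x) \<le> norm x" for x
  proof -
    have "Re (cinner (W (W x)) (W x)) \<le> norm (W x) * norm (W x)"
      using Re_cinner_le[of "W (W x)" "W x"] contr[of "W x"]
      by (meson mult_right_mono norm_ge_zero order_trans)
    moreover have "0 \<le> Re (cinner (W x) x) - 2 * (norm (W x))\<^sup>2 + Re (cinner (W (W x)) (W x))"
      using pos_semidef_Re_nonneg[OF W(2), of "x + - W x"] Re_cinner_form_add[OF W, of x "- W x"]
      by (simp add: cinner.minus_left cinner.minus_right cinner_norm W.neg del: of_real_power)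
    ultimately have "(norm (W x))\<^sup>2 \<le> Re (cinner (W x) x)"
      by (simp add: power2_eq_square)
    moreover have "Re (cinner x (W x)) = Re (cinner (W x) x)"
      by (simp add: pos_semidef_selfadjoint[OF W])
    ultimately have "(norm (T x))\<^sup>2 \<le> (norm x)\<^sup>2"
      using norm_add_square[of x "- W x"] pos_semidef_Re_nonneg[OF W(2), of x]
      by (simp add: T_def cinner.minus_right)
    then show ?thesis
      by (simp add: power2_le_iff_abs_le)
  qed
  obtain Y where Y: "bounded_linear Y" "\<And>x. norm (Y x) \<le> norm x"
      "\<And>x. 2 *\<^sub>R Y x = T x + Y (Y x)" and lim: "\<And>x. (\<lambda>n. half_iter T n x) \<longlonglongrightarrow> Y x"
    using half_iter_limit[OF T Tcontr] by blast
  interpret Y: bounded_linear Y by fact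
  have comm: "U (Y x) = Y (U x)" if U: "bounded_linear U" and UW: "\<And>x. U (W x) = W (U x)" for U x
  proof -
    interpret U: bounded_linear U by fact
    have "U (half_iter T n x) = half_iter T n (U x)" for n
      by (rule half_iter_commute[OF U]) (simp add: T_def U.diff UW)
    then show ?thesis
      using U.tendsto[OF lim[of x]] lim[of "U x"] by (auto intro: LIMSEQ_unique)
  qed
  have Yadj: "cinner (Y x) y = cinner x (Y y)" for x y
    using cinner.tendsto[OF lim[of x] tendsto_const[of y]] cinner.tendsto[OF tendsto_const[of x] lim[of y]]
    by (auto simp: half_iter_selfadjoint[OF adj] intro: LIMSEQ_unique)
  define R where "R = (\<lambda>x. x - Y x)"
  \<comment> \<open>The limit is so far only real-linear; complex scalar multiplication commutes
    with \<open>W\<close>, hence with \<open>Y\<close>.\<close>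
  have "c *\<^sub>C Y x = Y (c *\<^sub>C x)" for c x
    by (rule comm[OF bounded_linear_scaleC]) (simp add: Wc)
  then have R: "bounded_clinear R"
    by (simp add: bounded_clinear_def R_def scaleC_diff_right bounded_linear_sub
        bounded_linear_ident Y.bounded_linear_axioms)
  \<comment> \<open>Self-adjointness makes the form of \<open>Y\<close> real, and contractivity
    keeps it below the squared norm.\<close>
  have pos: "pos_semidef R"
    unfolding pos_semidef_def
  proof
    fix x
    have "Im (cinner (Y x) x) = 0"
      using Yadj[of x x] cinner_commute[of "Y x" x] by (metis Reals_cnj_iff complex_is_Real_iff)
    moreover have "Re (cinner (Y x) x) \<le> norm x * norm x"
      using Re_cinner_le[of "Y x" x] Y(2)[of x] by (meson mult_right_mono norm_ge_zero order_trans)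
    ultimately show "cinner (R x) x \<in> \<real>\<^sub>\<ge>\<^sub>0"
      by (simp add: R_def cinner.diff_left cinner_norm complex_nonneg_Reals_iff power2_eq_square)
  qed
  have "R (R x) = W x" for x
  proof -
    have "R (R x) = x - 2 *\<^sub>R Y x + Y (Y x)"
      by (simp add: R_def Y.diff scaleR_2)
    then show ?thesis
      by (simp add: Y(3) T_def)
  qed
  then have "R \<circ> R = W"
    by auto
  moreover have "U (R x) = R (U x)" if "bounded_linear U" "\<And>x. U (W x) = W (U x)" for U x
    using comm[OF that] bounded_linear.linear[OF that(1)] by (simp add: R_def linear_diff)
  ultimately show ?thesis
    using that[OF R pos] by blast
qed

section \<open>Roots of arbitrary bounded positive operators\<close>

lemma bounded_clinear_scaleR:
  "bounded_clinear W \<Longrightarrow> bounded_clinear (\<lambda>x. r *\<^sub>R W x)"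
  by (simp add: bounded_clinear_def bounded_linear_const_scaleR)
    (simp add: scaleR_scaleC scaleC_scaleC mult.commute)

lemma pos_semidef_scaleR:
  "pos_semidef W \<Longrightarrow> 0 \<le> r \<Longrightarrow> pos_semidef (\<lambda>x. r *\<^sub>R W x)"
  by (auto simp: pos_semidef_def cinner_scaleR_left complex_nonneg_Reals_iff)

text \<open>Dividing \<open>W\<close> by a positive bound \<open>K\<close> gives a contraction; its
  root is multiplied by \<open>sqrt K\<close>.\<close>

lemma positive_sqrt:
  assumes W: "bounded_clinear W" "pos_semidef W"
  obtains R where "bounded_clinear R" "pos_semidef R" "R \<circ> R = W"
    "\<And>U x. bounded_linear U \<Longrightarrow> (\<And>x. U (W x) = W (U x)) \<Longrightarrow> U (R x) = R (U x)"
proof -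
  obtain K where K: "0 < K" "\<And>x. norm (W x) \<le> norm x * K"
    using W(1) bounded_linear.pos_bounded unfolding bounded_clinear_def by blast
  have "norm ((1/K) *\<^sub>R W x) \<le> norm x" for x
    using K(1) K(2)[of x] by (simp add: divide_simps)
  then obtain R where R: "bounded_clinear R" "pos_semidef R" "R \<circ> R = (\<lambda>x. (1/K) *\<^sub>R W x)"
    and comm: "\<And>U x. bounded_linear U \<Longrightarrow> (\<And>x. U ((1/K) *\<^sub>R W x) = (1/K) *\<^sub>R W (U x)) \<Longrightarrow> U (R x) = R (U x)"
    using positive_contraction_sqrt[of "\<lambda>x. (1/K) *\<^sub>R W x"] bounded_clinear_scaleR[OF W(1), of "1/K"]
      pos_semidef_scaleR[OF W(2), of "1/K"] K(1) by auto
  have linR: "linear R"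
    using R(1) by (simp add: bounded_clinear_def bounded_linear.linear)
  define Q where "Q = (\<lambda>x. sqrt K *\<^sub>R R x)"
  have "Q (Q x) = W x" for x
  proof -
    have "R (R x) = (1/K) *\<^sub>R W x"
      using fun_cong[OF R(3), of x] by simp
    moreover have "Q (Q x) = (sqrt K * sqrt K) *\<^sub>R R (R x)"
      by (simp add: Q_def linear_scale[OF linR])
    ultimately show ?thesis
      using K(1) by simp
  qed
  then have "Q \<circ> Q = W"
    by auto
  moreover have "U (Q x) = Q (U x)" if U: "bounded_linear U" "\<And>x. U (W x) = W (U x)" for U x
  proof -
    have "linear U"
      using U(1) by (rule bounded_linear.linear)
    then show ?thesis
      using comm[OF U(1), of x] by (simp add: Q_def linear_scale U(2))
  qed
  moreover have "bounded_clinear Q" "pos_semidef Q"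
    unfolding Q_def using R K(1) by (auto intro: bounded_clinear_scaleR pos_semidef_scaleR)
  ultimately show ?thesis
    using that by blast
qed

text \<open>By commutation \<open>R + Q\<close> annihilates \<open>y = R x - Q x\<close>, so both
  nonnegative forms vanish at \<open>y\<close> and \<open>R y = Q y = 0\<close>. Moving
  \<open>R\<close> and \<open>Q\<close> across the inner product gives
  \<open>cinner y y = 0\<close>.\<close>

lemma positive_sqrt_unique:
  assumes R: "bounded_clinear R" "pos_semidef R" and Q: "bounded_clinear Q" "pos_semidef Q"
    and sq: "R \<circ> R = Q \<circ> Q" and comm: "\<And>x. Q (R x) = R (Q x)"
  shows "Q = R"
proof
  fix x
  interpret R: bounded_linear R
    using R(1) by (simp add: bounded_clinear_def)
  interpret Q: bounded_linear Q
    using Q(1) by (simp add: bounded_clinear_def)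
  define y where "y = R x - Q x"
  have "R y + Q y = 0"
    using fun_cong[OF sq, of x] comm[of x] by (simp add: y_def R.diff Q.diff)
  then have "Re (cinner (R y) y) + Re (cinner (Q y) y) = 0"
    by (metis cinner.zero_left cinner_add_left plus_complex.sel(1) zero_complex.sel(1))
  then have "R y = 0" "Q y = 0"
    using pos_semidef_Re_nonneg[OF R(2), of y] pos_semidef_Re_nonneg[OF Q(2), of y]
    by (auto intro: pos_semidef_eq_0 R Q)
  then have "cinner y y = 0"
    unfolding y_def
    by (simp add: cinner.diff_left pos_semidef_selfadjoint[OF R] pos_semidef_selfadjoint[OF Q]
        cinner.zero_right)
  then show "Q x = R x"
    by (simp add: cinner_norm y_def)
qed

text \<open>Any root \<open>Q\<close> commutes with its own square \<open>W\<close>, hence with the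
  constructed root, so uniqueness among commuting roots becomes uniqueness outright.\<close>

lemma op_sqrt:
  assumes "bounded_clinear W" "pos_semidef W"
  shows "bounded_clinear (op_sqrt W)" "pos_semidef (op_sqrt W)" "op_sqrt W \<circ> op_sqrt W = W"
proof -
  obtain R where R: "bounded_clinear R" "pos_semidef R" "R \<circ> R = W"
    and comm: "\<And>U x. bounded_linear U \<Longrightarrow> (\<And>x. U (W x) = W (U x)) \<Longrightarrow> U (R x) = R (U x)"
    using positive_sqrt[OF assms] by blast
  have "Q = R" if Q: "bounded_clinear Q" "pos_semidef Q" "Q \<circ> Q = W" for Q
  proof (rule positive_sqrt_unique[OF R(1,2) Q(1,2)])
    have "bounded_linear Q"
      using Q(1) by (simp add: bounded_clinear_def)
    then show "Q (R x) = R (Q x)" for x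
      by (rule comm) (simp add: Q(3)[symmetric])
  qed (simp add: R Q)
  then have "\<exists>!R. bounded_clinear R \<and> pos_semidef R \<and> R \<circ> R = W"
    using R by blast
  from theI'[OF this]
  show "bounded_clinear (op_sqrt W)" "pos_semidef (op_sqrt W)" "op_sqrt W \<circ> op_sqrt W = W"
    by (auto simp: op_sqrt_def)
qed

lemma wnorm_square:
  assumes "bounded_clinear W" "pos_semidef W"
  shows "(wnorm W x)\<^sup>2 = Re (cinner (W x) x)"
proof -
  have "W x = op_sqrt W (op_sqrt W x)"
    using fun_cong[OF op_sqrt(3)[OF assms], of x] by simp
  then have "cinner (W x) x = cinner (op_sqrt W x) (op_sqrt W x)"
    by (simp add: pos_semidef_selfadjoint op_sqrt[OF assms])
  then show ?thesis
    by (simp add: cinner_norm wnorm_def del: of_real_power)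
qed

text \<open>Both seminorms are nonnegative, so their squares may be compared; from here on the root
  is replaced by the quadratic form.\<close>

lemma wnorm_le_iff:
  assumes "bounded_clinear W" "pos_semidef W"
  shows "wnorm W x \<le> wnorm W y \<longleftrightarrow> Re (cinner (W x) x) \<le> Re (cinner (W y) y)"
  unfolding wnorm_square[OF assms, symmetric] by (simp add: wnorm_def)

section \<open>Linear subspaces and linear relations\<close>

definition csubspace :: "'h::complex_hilbert set \<Rightarrow> bool" where
  "csubspace S \<longleftrightarrow> 0 \<in> S \<and> (\<forall>x\<in>S. \<forall>y\<in>S. x + y \<in> S) \<and> (\<forall>c. \<forall>x\<in>S. c *\<^sub>C x \<in> S)"

lemma csubspace_0: "csubspace S \<Longrightarrow> 0 \<in> S"
  and csubspace_add: "csubspace S \<Longrightarrow> x \<in> S \<Longrightarrow> y \<in> S \<Longrightarrow> x + y \<in> S"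
  and csubspace_scaleC: "csubspace S \<Longrightarrow> x \<in> S \<Longrightarrow> c *\<^sub>C x \<in> S"
  by (auto simp: csubspace_def)

lemma csubspace_minus: "csubspace S \<Longrightarrow> x \<in> S \<Longrightarrow> - x \<in> S"
  unfolding uminus_eq_scaleC by (rule csubspace_scaleC)

lemma csubspace_diff: "csubspace S \<Longrightarrow> x \<in> S \<Longrightarrow> y \<in> S \<Longrightarrow> x - y \<in> S"
  using csubspace_add[of S x "- y"] csubspace_minus[of S y] by simp

lemma csubspace_Int: "csubspace S \<Longrightarrow> csubspace N \<Longrightarrow> csubspace (S \<inter> N)"
  by (auto simp: csubspace_def)

lemma linear_relation_0: "linear_relation A \<Longrightarrow> (0, 0) \<in> A"
  and linear_relation_add: "linear_relation A \<Longrightarrow> (x, y) \<in> A \<Longrightarrow> (x', y') \<in> A \<Longrightarrow> (x + x', y + y') \<in> A"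
  and linear_relation_scaleC: "linear_relation A \<Longrightarrow> (x, y) \<in> A \<Longrightarrow> (c *\<^sub>C x, c *\<^sub>C y) \<in> A"
  by (auto simp: linear_relation_def)

lemma csubspace_Range: "linear_relation A \<Longrightarrow> csubspace (Range A)"
  unfolding csubspace_def
  by (blast intro: linear_relation_0 linear_relation_add linear_relation_scaleC)

lemma csubspace_mul: "linear_relation A \<Longrightarrow> csubspace (mul A)"
  using linear_relation_add[of A 0 _ 0] linear_relation_scaleC[of A 0]
  by (auto simp: csubspace_def mul_def linear_relation_0
      linear_0[OF bounded_linear.linear[OF bounded_linear_scaleC]])

lemma csubspace_wperp:
  assumes "bounded_clinear W"
  shows "csubspace (wperp W S)"
proof -
  interpret bounded_linear W
    using assms by (simp add: bounded_clinear_def)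
  show ?thesis
    using assms
    by (simp add: csubspace_def wperp_def bounded_clinear_def zero add cinner.zero_left
        cinner_add_left cinner_scaleC_left)
qed

lemma linear_relation_diff:
  assumes "linear_relation A" "(x, y) \<in> A" "(x', y') \<in> A"
  shows "(x - x', y - y') \<in> A"
proof -
  have "(- x', - y') \<in> A"
    unfolding uminus_eq_scaleC using assms(1,3) by (rule linear_relation_scaleC)
  then show ?thesis
    using linear_relation_add[OF assms(1,2)] by fastforce
qed

lemma linear_relation_Image_singleton:
  assumes A: "linear_relation A" and z: "(x, z) \<in> A"
  shows "y \<in> A `` {x} \<longleftrightarrow> y - z \<in> mul A"
proof
  assume "y \<in> A `` {x}"
  then show "y - z \<in> mul A"
    using linear_relation_diff[OF A _ z, of x y] by (simp add: mul_def)
next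
  assume "y - z \<in> mul A"
  then have "(0 + x, (y - z) + z) \<in> A"
    unfolding mul_def mem_Collect_eq using z by (rule linear_relation_add[OF A])
  then show "y \<in> A `` {x}"
    by simp
qed

section \<open>The weighted projection and its cosets\<close>

lemma wproj_iff: "(b, t) \<in> wproj W S \<longleftrightarrow> t \<in> S \<and> b - t \<in> wperp W S"
proof
  assume "t \<in> S \<and> b - t \<in> wperp W S"
  then have "(t + (b - t), t) \<in> wproj W S"
    unfolding wproj_def by blast
  then show "(b, t) \<in> wproj W S"
    by simp
qed (auto simp: wproj_def)

lemma mul_wproj:
  assumes "bounded_clinear W"
  shows "mul (wproj W S) = S \<inter> wperp W S"
proof -
  have "- y \<in> wperp W S \<longleftrightarrow> y \<in> wperp W S" for y
    using csubspace_minus[OF csubspace_wperp[OF assms], of y S]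
      csubspace_minus[OF csubspace_wperp[OF assms], of "- y" S] by auto
  then show ?thesis
    by (auto simp: mul_def wproj_iff)
qed

text \<open>Two decompositions of \<open>b\<close> differ by a vector lying in both
  summands.\<close>

lemma wproj_Image_singleton:
  assumes "bounded_clinear W" "csubspace S" "s \<in> S" "b - s \<in> wperp W S"
  shows "t \<in> wproj W S `` {b} \<longleftrightarrow> t - s \<in> S \<inter> wperp W S"
proof -
  note N = csubspace_wperp[OF assms(1), of S]
  have "t \<in> wproj W S `` {b} \<longleftrightarrow> t \<in> S \<and> b - t \<in> wperp W S"
    by (simp add: wproj_iff)
  also have "t \<in> S \<longleftrightarrow> t - s \<in> S"
    using csubspace_diff[OF assms(2) _ assms(3), of t] csubspace_add[OF assms(2) _ assms(3), of "t - s"] by auto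
  also have "b - t \<in> wperp W S \<longleftrightarrow> t - s \<in> wperp W S"
    using csubspace_diff[OF N assms(4), of "b - t"] csubspace_diff[OF N assms(4), of "t - s"] by auto
  finally show ?thesis
    by simp
qed

section \<open>Weighted least squares solutions\<close>

text \<open>Minimality along every line through \<open>z\<close> in \<open>S\<close> gives
  orthogonality. Conversely, in the expansion of the form at
  \<open>y - b = (z - b) + (y - z)\<close> the cross term vanishes, as in Pythagoras.\<close>

lemma wnorm_best_approx_iff:
  assumes W: "bounded_clinear W" "pos_semidef W" and S: "csubspace S" and z: "z \<in> S"
  shows "(\<forall>y\<in>S. wnorm W (z - b) \<le> wnorm W (y - b)) \<longleftrightarrow> z - b \<in> wperp W S"
proof
  assume min: "\<forall>y\<in>S. wnorm W (z - b) \<le> wnorm W (y - b)"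
  show "z - b \<in> wperp W S"
    unfolding wperp_def mem_Collect_eq
  proof
    fix s assume "s \<in> S"
    then have "z + c *\<^sub>C s \<in> S" for c
      using S z by (simp add: csubspace_add csubspace_scaleC)
    then have "wnorm W (z - b) \<le> wnorm W (z - b + c *\<^sub>C s)" for c
      using min by (metis add_diff_eq diff_add_eq)
    then show "cinner (W (z - b)) s = 0"
      by (intro cinner_eq_0_if_form_minimal[OF W]) (simp add: wnorm_le_iff[OF W])
  qed
next
  assume perp: "z - b \<in> wperp W S"
  show "\<forall>y\<in>S. wnorm W (z - b) \<le> wnorm W (y - b)"
  proof
    fix y assume "y \<in> S"
    then have "cinner (W (z - b)) (y - z) = 0"
      using perp csubspace_diff[OF S _ z] by (simp add: wperp_def)
    then have "Re (cinner (W (z - b)) (z - b)) \<le> Re (cinner (W (z - b + (y - z))) (z - b + (y - z)))"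
      unfolding Re_cinner_form_add[OF W] using pos_semidef_Re_nonneg[OF W(2), of "y - z"] by simp
    then show "wnorm W (z - b) \<le> wnorm W (y - b)"
      by (simp add: wnorm_le_iff[OF W])
  qed
qed

lemma wls_solution_iff_wperp:
  assumes "bounded_clinear W" "pos_semidef W" "linear_relation A"
  shows "wls_solution W A b x0 \<longleftrightarrow> (\<exists>z. (x0, z) \<in> A \<and> z - b \<in> wperp W (Range A))"
proof -
  have "(\<forall>y\<in>Range A. wnorm W (z - b) \<le> wnorm W (y - b)) \<longleftrightarrow> z - b \<in> wperp W (Range A)"
    if "(x0, z) \<in> A" for z
    using that by (intro wnorm_best_approx_iff[OF assms(1,2) csubspace_Range[OF assms(3)]]) auto
  then show ?thesis
    unfolding wls_solution_def by blast
qed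

text \<open>Here \<open>X\<close> is \<open>z + M\<close> and \<open>Y\<close> is
  \<open>s + N\<close>, so both sums are cosets of \<open>M + N\<close>. They coincide exactly when
  \<open>X\<close> meets \<open>Y\<close>.\<close>

lemma coset_eq_iff:
  assumes M: "csubspace M" and N: "csubspace N"
    and X: "\<And>y. y \<in> X \<longleftrightarrow> y - z \<in> M" and Y: "\<And>y. y \<in> Y \<longleftrightarrow> y - s \<in> N"
  shows "X + N = Y + M \<longleftrightarrow> (\<exists>y\<in>X. y - s \<in> N)"
proof
  assume "X + N = Y + M"
  moreover have "s + 0 \<in> Y + M"
    using Y csubspace_0[OF M] csubspace_0[OF N] by (intro set_plus_intro) auto
  ultimately have "s \<in> X + N"
    by simp
  then obtain y n where "y \<in> X" "n \<in> N" "s = y + n"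
    by (auto elim: set_plus_elim)
  then have "y - s = - n"
    by simp
  then show "\<exists>y\<in>X. y - s \<in> N"
    using \<open>y \<in> X\<close> \<open>n \<in> N\<close> csubspace_minus[OF N] by metis
next
  assume "\<exists>y\<in>X. y - s \<in> N"
  then obtain y where y: "y - z \<in> M" "y - s \<in> N"
    using X by blast
  show "X + N = Y + M"
  proof (intro equalityI subsetI)
    fix v assume "v \<in> X + N"
    then obtain u n where v: "v = u + n" "u - z \<in> M" "n \<in> N"
      using X by (auto elim: set_plus_elim)
    \<comment> \<open>Both cosets are rewritten with the common point \<open>y\<close> as
      base.\<close>
    have "(y + n) + (u - y) \<in> Y + M"
    proof (rule set_plus_intro)
      show "y + n \<in> Y"
        using csubspace_add[OF N y(2) v(3)] by (simp add: Y algebra_simps)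
      show "u - y \<in> M"
        using csubspace_diff[OF M v(2) y(1)] by simp
    qed
    then show "v \<in> Y + M"
      by (simp add: v(1) algebra_simps)
  next
    fix v assume "v \<in> Y + M"
    then obtain u m where v: "v = u + m" "u - s \<in> N" "m \<in> M"
      using Y by (auto elim: set_plus_elim)
    have "(y + m) + (u - y) \<in> X + N"
    proof (rule set_plus_intro)
      show "y + m \<in> X"
        using csubspace_add[OF M y(1) v(3)] by (simp add: X algebra_simps)
      show "u - y \<in> N"
        using csubspace_diff[OF N v(2) y(2)] by simp
    qed
    then show "v \<in> X + N"
      by (simp add: v(1) algebra_simps)
  qed
qed

lemma wls_solution_iff_projection:
  assumes W: "bounded_clinear W" "pos_semidef W" and A: "linear_relation A"
    and b: "b \<in> Domain (wproj W (Range A))"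
  shows "wls_solution W A b x0 \<longleftrightarrow>
    A `` {x0} + mul (wproj W (Range A)) = wproj W (Range A) `` {b} + mul A"
proof -
  define S where "S = Range A"
  note S = csubspace_Range[OF A, folded S_def] and M = csubspace_mul[OF A]
    and P = csubspace_wperp[OF W(1), of S]
  from b obtain s where s: "s \<in> S" "b - s \<in> wperp W S"
    unfolding Domain_iff wproj_iff S_def by blast
  show ?thesis
    unfolding S_def[symmetric] mul_wproj[OF W(1)]
  proof (cases "A `` {x0} = {}")
    \<comment> \<open>Outside the domain of \<open>A\<close> both sides fail: the left sum is empty,
      whereas the right one contains \<open>s\<close>.\<close>
    case True
    have "s + 0 \<in> wproj W S `` {b} + mul A"
      using wproj_Image_singleton[OF W(1) S s] csubspace_0[OF S] csubspace_0[OF P] csubspace_0[OF M]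
      by (intro set_plus_intro) auto
    moreover have "A `` {x0} + (S \<inter> wperp W S) = {}"
      using True by (auto elim: set_plus_elim)
    ultimately show "wls_solution W A b x0 \<longleftrightarrow>
        A `` {x0} + (S \<inter> wperp W S) = wproj W S `` {b} + mul A"
      using True by (auto simp: wls_solution_def)
  next
    case False
    then obtain z where z: "(x0, z) \<in> A"
      by auto
    have "A `` {x0} + (S \<inter> wperp W S) = wproj W S `` {b} + mul A \<longleftrightarrow>
        (\<exists>y\<in>A `` {x0}. y - s \<in> S \<inter> wperp W S)"
      by (rule coset_eq_iff[OF M csubspace_Int[OF S P] linear_relation_Image_singleton[OF A z]
            wproj_Image_singleton[OF W(1) S s]])
    \<comment> \<open>Membership of \<open>y - s\<close> in \<open>S\<close> is automatic, and
      \<open>y - s\<close> differs from \<open>y - b\<close> by \<open>b - s\<close>, which is in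
      \<open>wperp W S\<close>.\<close>
    also have "\<dots> \<longleftrightarrow> (\<exists>y. (x0, y) \<in> A \<and> y - b \<in> wperp W S)"
    proof -
      have "y - s \<in> S" if "(x0, y) \<in> A" for y
        using that s(1) by (intro csubspace_diff[OF S]) (auto simp: S_def)
      moreover have "y - s \<in> wperp W S \<longleftrightarrow> y - b \<in> wperp W S" for y
        using csubspace_diff[OF P _ s(2), of "y - s"] csubspace_add[OF P _ s(2), of "y - b"] by auto
      ultimately show ?thesis
        by auto
    qed
    finally show "wls_solution W A b x0 \<longleftrightarrow>
        A `` {x0} + (S \<inter> wperp W S) = wproj W S `` {b} + mul A"
      by (simp add: wls_solution_iff_wperp[OF W A] S_def)
  qed
qed

section \<open>The adjoint relation and the normal equation\<close>

lemma relation_product_graph_iff: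
  "(u, v) \<in> relation_product T (graph W) \<longleftrightarrow> (W u, v) \<in> T"
  by (auto simp: relation_product_def graph_def)

text \<open>The kernel of the adjoint is the orthogonal complement of the range.\<close>

lemma rel_adj_0_iff_wperp: "(W u, 0) \<in> rel_adj A \<longleftrightarrow> u \<in> wperp W (Range A)"
proof -
  have "cinner g (W u) = 0 \<longleftrightarrow> cinner (W u) g = 0" for g
    by (metis cinner_commute complex_cnj_zero)
  then show ?thesis
    by (auto simp: rel_adj_def wperp_def cinner.zero_right)
qed

lemma rel_adj_add_kernel:
  assumes "(x, 0) \<in> rel_adj A"
  shows "(x + y, v) \<in> rel_adj A \<longleftrightarrow> (y, v) \<in> rel_adj A"
  using assms by (force simp: rel_adj_def cinner_add_right cinner.zero_right)

text \<open>For a solution, \<open>A x0 - b\<close> is \<open>mul A\<close> shifted by some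
  \<open>z - b\<close> for which \<open>W (z - b)\<close> lies in the kernel of the adjoint, and
  such a shift leaves the image unchanged.\<close>

lemma wls_solution_iff_normal_equation:
  assumes W: "bounded_clinear W" "pos_semidef W" and A: "linear_relation A"
  shows "wls_solution W A b x0 \<longleftrightarrow>
    relation_product (rel_adj A) (graph W) `` set_minus_vec (A `` {x0}) b =
    relation_product (rel_adj A) (graph W) `` mul A"
    (is "_ \<longleftrightarrow> ?T `` _ = _")
proof
  assume "wls_solution W A b x0"
  then obtain z where z: "(x0, z) \<in> A" and "z - b \<in> wperp W (Range A)"
    by (auto simp: wls_solution_iff_wperp[OF W A])
  then have "(W (z - b), 0) \<in> rel_adj A"
    by (simp add: rel_adj_0_iff_wperp)
  moreover have "W (z - b + m) = W (z - b) + W m" for m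
    using W(1) by (simp add: bounded_clinear_def linear_simps)
  ultimately have ker: "(z - b + m, v) \<in> ?T \<longleftrightarrow> (m, v) \<in> ?T" for m v
    by (simp add: relation_product_graph_iff rel_adj_add_kernel)
  have "set_minus_vec (A `` {x0}) b = (\<lambda>m. z - b + m) ` mul A"
  proof (intro equalityI subsetI)
    fix u assume "u \<in> set_minus_vec (A `` {x0}) b"
    then obtain y where y: "y \<in> A `` {x0}" "u = y - b"
      by (auto simp: set_minus_vec_def)
    then have "y - z \<in> mul A"
      by (simp only: linear_relation_Image_singleton[OF A z])
    moreover have "u = z - b + (y - z)"
      by (simp add: y(2))
    ultimately show "u \<in> (\<lambda>m. z - b + m) ` mul A"
      by blast
  next
    fix u assume "u \<in> (\<lambda>m. z - b + m) ` mul A"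
    then obtain m where m: "m \<in> mul A" "u = z - b + m"
      by blast
    then have "z + m \<in> A `` {x0}"
      unfolding linear_relation_Image_singleton[OF A z] by simp
    moreover have "u = (z + m) - b"
      by (simp add: m(2))
    ultimately show "u \<in> set_minus_vec (A `` {x0}) b"
      unfolding set_minus_vec_def by blast
  qed
  then show "?T `` set_minus_vec (A `` {x0}) b = ?T `` mul A"
    using ker by (auto simp: Image_iff)
next
  assume eq: "?T `` set_minus_vec (A `` {x0}) b = ?T `` mul A"
  have "W 0 = 0"
    using W(1) by (simp add: bounded_clinear_def linear_simps)
  then have "(0, 0) \<in> ?T"
    by (auto simp: relation_product_graph_iff rel_adj_def cinner.zero_right)
  \<comment> \<open>Comparing the two sets at the single vector 0 suffices: a preimage of 0 on the
    left is some \<open>z - b\<close> with \<open>z\<close> in \<open>A x0\<close>, which also puts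
    \<open>x0\<close> in the domain.\<close>
  then have "0 \<in> ?T `` mul A"
    using csubspace_0[OF csubspace_mul[OF A]] by blast
  then obtain z where "(x0, z) \<in> A" "(z - b, 0) \<in> ?T"
    unfolding eq[symmetric] by (auto simp: set_minus_vec_def)
  then show "wls_solution W A b x0"
    by (auto simp: wls_solution_iff_wperp[OF W A] relation_product_graph_iff rel_adj_0_iff_wperp)
qed

theorem corollary5p4:
  fixes W :: "'h::complex_hilbert \<Rightarrow> 'h"
    and A :: "('h \<times> 'h) set"
    and b x0 :: 'h
  assumes "separable_space (euclidean :: 'h topology)"
    and "bounded_clinear W" and "pos_semidef W"
    and "linear_relation A"
    and "b \<in> Domain (wproj W (Range A))"
  shows "(wls_solution W A b x0 \<longleftrightarrow>
            A `` {x0} + mul (wproj W (Range A)) = wproj W (Range A) `` {b} + mul A) \<and>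
         (wls_solution W A b x0 \<longleftrightarrow>
            relation_product (rel_adj A) (graph W) `` set_minus_vec (A `` {x0}) b =
            relation_product (rel_adj A) (graph W) `` mul A)"
  using wls_solution_iff_projection[OF assms(2-5)] wls_solution_iff_normal_equation[OF assms(2-4)]
  by blast

end
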